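(* Let $\epsilon\in\{0,1,-1\}$, let $\delta=(1-\epsilon)/2$, and let $\theta(x)$ be an elementary function such that $$\theta(-x)=-\theta(x-\epsilon).$$ Then, in the sense of the generalized limits described in the context, $$\lim_{n\to\infty}\theta(n+\delta)=0.$$
   Context: Re-ordering of $\mathbb{Z}$: $a\prec b$ iff $\frac{-1}{a}<\frac{-1}{b}$ (convention $0^{-1}=\infty$), so that $0\prec 1\prec 2\prec\cdots\prec -2\prec -1$ (first element $0$, last element $-1$). Intervals $[a,b]$, $(a,b)$ are taken with respect to $\prec$. Put $\mathbb{Z}_{a,b}=[a,b]$ if $a\preceq b$, and $\mathbb{Z}_{a,b}=\mathbb{Z}\setminus(b,a)=[a,-1]\cup[0,b]$ if $b\prec a$. For a function $f$ on $\mathbb{Z}$ and any $a,b\in\mathbb{Z}$, $\sum_{u=a}^{b}f(u):=\sum_{u\in\mathbb{Z}_{a,b}}f(u)$ (observing the order of elements in $\mathbb{Z}_{a,b}$); if $\mathbb{Z}_{a,b}$ is infinite this is an infinite series. An elementary function is one given by a formula built by finitely many algebraic operations, compositions and combinations from constant, algebraic, trigonometric and exponential functions and their inverses. A function $f$ on $\mathbb{Z}$ is regular if there is an elementary function $F$ (a primitive of $f$) with $F(x+1)-F(x)=f(x)$ for all $x\in\mathbb{Z}$. Summation method. Postulate: every series $\sum_{u=1}^{\infty}f(u)$ with $f$ regular has a certain finite numeric value. Axioms: (A1) if $S_n=\sum_{u=a}^{n}f(u)$ for all $n$, then $\lim_{n\to\infty}S_n=\sum_{u=a}^{\infty}f(u)$;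 (A2) if $S_n=\sum_{u=1}^{[n/2]}f(u)$ for all $n$, then $\lim_{n\to\infty}S_n=\sum_{u=1}^{\infty}f(u)$ ($[\cdot]$ = integer part); (A3) if $\sum_{u=a}^{\infty}f_1(u)=S_1$ and $\sum_{u=a}^{\infty}f_2(u)=S_2$, then $\sum_{u=a}^{\infty}(\alpha_1f_1(u)+\alpha_2f_2(u))=\alpha_1S_1+\alpha_2S_2$; (A4) if $G=[a_1,b_1]\cup[a_2,b_2]$ with $[a_1,b_1]\cap[a_2,b_2]=\emptyset$, then $\sum_{u\in G}f(u)=\sum_{u=a_1}^{b_1}f(u)+\sum_{u=a_2}^{b_2}f(u)$. Limits: $\lim_{n\to\infty}F(n)=A$ means $\sum_{u=1}^{\infty}f(u)=A$ where $f(1)=F(1)$ and $f(u)=F(u)-F(u-1)$ for $u>1$; by the postulate every elementary function of an integer argument defined on $\mathbb{Z}$ has a definite limit. All limits and infinite sums are understood in this generalized sense (agreeing with the usual one for convergent sequences and series). Conventions: sums retain their analytical expression, i.e. for $f$ regular with primitive $F$, $\sum_{u=a}^{b}f(u)=F(b+1)-F(a)$ whenever $a\preceq b$; and $\lim_{n\to\infty}\sum_{u\in\mathbb{Z}_{-n,n}}f(u)=\sum_{u\in\mathbb{Z}}f(u)$. *)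

theory Defs
  imports "HOL-Analysis.Analysis" "HOL-Computational_Algebra.Polynomial"
begin

section \<open>The re-ordering of the integers\<close>

text \<open>In \<^typ>\<open>ereal\<close> one has \<open>inverse 0 = \<infinity>\<close>, hence \<open>-1 / 0 = -\<infinity>\<close>:
  the least element is 0 and the greatest one is -1.\<close>

definition prec :: "int \<Rightarrow> int \<Rightarrow> bool"  (infix "\<prec>\<^sub>Z" 50) where
  "a \<prec>\<^sub>Z b \<longleftrightarrow> - 1 / ereal (of_int a) < - 1 / ereal (of_int b)"

definition preceq :: "int \<Rightarrow> int \<Rightarrow> bool"  (infix "\<preceq>\<^sub>Z" 50) where
  "a \<preceq>\<^sub>Z b \<longleftrightarrow> a \<prec>\<^sub>Z b \<or> a = b"

definition closed_ivl :: "int \<Rightarrow> int \<Rightarrow> int set" where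
  "closed_ivl a b = {u. a \<preceq>\<^sub>Z u \<and> u \<preceq>\<^sub>Z b}"

definition open_ivl :: "int \<Rightarrow> int \<Rightarrow> int set" where
  "open_ivl a b = {u. a \<prec>\<^sub>Z u \<and> u \<prec>\<^sub>Z b}"

definition Zset :: "int \<Rightarrow> int \<Rightarrow> int set" where
  "Zset a b = (if a \<preceq>\<^sub>Z b then closed_ivl a b else UNIV - open_ivl b a)"


section \<open>Elementary and regular functions\<close>

text \<open>Functions given by formulas are partial functions of a real variable; a formula has
  no value where a denominator vanishes or where an argument leaves the domain of an inverse
  function.\<close>

definition pointwise ::
    "(real \<Rightarrow> real \<Rightarrow> real) \<Rightarrow> (real \<rightharpoonup> real) \<Rightarrow> (real \<rightharpoonup> real) \<Rightarrow> (real \<rightharpoonup> real)" where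
  "pointwise h f g = (\<lambda>x. case (f x, g x) of (Some y, Some z) \<Rightarrow> Some (h y z) | _ \<Rightarrow> None)"

definition quotient_fun :: "(real \<rightharpoonup> real) \<Rightarrow> (real \<rightharpoonup> real) \<Rightarrow> (real \<rightharpoonup> real)" where
  "quotient_fun f g = (\<lambda>x. if g x = Some 0 then None else pointwise (/) f g x)"

text \<open>A (branch of an) algebraic function: a continuous solution \<open>y = g x\<close> of a nontrivial
  polynomial equation \<open>P(x, y) = 0\<close> on a nondegenerate interval. The outer variable of
  \<open>P\<close> is \<open>y\<close>. Without continuity on an interval, any 0-1-valued function would qualify, through
  \<open>y\<^sup>2 = y\<close>.\<close>

definition algebraic_fun :: "(real \<rightharpoonup> real) \<Rightarrow> bool" where
  "algebraic_fun g \<longleftrightarrow>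
     is_interval (dom g) \<and> interior (dom g) \<noteq> {} \<and>
     continuous_on (dom g) (\<lambda>x. the (g x)) \<and>
     (\<exists>P :: real poly poly. P \<noteq> 0 \<and> (\<forall>x y. g x = Some y \<longrightarrow> poly (poly P [:y:]) x = 0))"

text \<open>The remaining trigonometric functions, the remaining branches of the inverse ones, general
  powers, and so on arise from the operations; the inverse of an algebraic function is algebraic.\<close>

inductive elementary :: "(real \<rightharpoonup> real) \<Rightarrow> bool" where
  const_fun: "elementary (\<lambda>x. Some c)"
| algebraic: "algebraic_fun g \<Longrightarrow> elementary g"
| exponential: "elementary (\<lambda>x. Some (exp x))"
| sine: "elementary (\<lambda>x. Some (sin x))"
| cosine: "elementary (\<lambda>x. Some (cos x))"
| logarithm: "elementary (\<lambda>x. if 0 < x then Some (ln x) else None)"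
| arcsine: "elementary (\<lambda>x. if - 1 \<le> x \<and> x \<le> 1 then Some (arcsin x) else None)"
| arccosine: "elementary (\<lambda>x. if - 1 \<le> x \<and> x \<le> 1 then Some (arccos x) else None)"
| arctangent: "elementary (\<lambda>x. Some (arctan x))"
| plus: "elementary f \<Longrightarrow> elementary g \<Longrightarrow> elementary (pointwise (+) f g)"
| minus: "elementary f \<Longrightarrow> elementary g \<Longrightarrow> elementary (pointwise (-) f g)"
| times: "elementary f \<Longrightarrow> elementary g \<Longrightarrow> elementary (pointwise (*) f g)"
| quotient: "elementary f \<Longrightarrow> elementary g \<Longrightarrow> elementary (quotient_fun f g)"
| composition: "elementary f \<Longrightarrow> elementary g \<Longrightarrow> elementary (f \<circ>\<^sub>m g)"

definition primitive_of :: "(real \<rightharpoonup> real) \<Rightarrow> (int \<Rightarrow> real) \<Rightarrow> bool" where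
  "primitive_of F f \<longleftrightarrow> elementary F \<and> (\<forall>x::int. of_int x \<in> dom F) \<and>
     (\<forall>x::int. the (F (of_int (x + 1))) - the (F (of_int x)) = f x)"

definition regular :: "(int \<Rightarrow> real) \<Rightarrow> bool" where
  "regular f \<longleftrightarrow> (\<exists>F. primitive_of F f)"


section \<open>The summation method\<close>

text \<open>A summation method consists of two maps: \<open>total G f\<close> is the sum of \<open>f\<close> over the set
  \<open>G\<close> of integers, and \<open>series a f\<close> is the value of the series of the \<open>f u\<close>
  from \<open>u = a\<close> to infinity, \<^const>\<open>None\<close> if it has no value. The start index is
  kept as an argument because these values need not be invariant under a shift of the index.

  \<open>glim series F\<close> is the generalized limit of \<open>F n\<close> for \<open>n\<close> tending to infinity
  (\<^const>\<open>None\<close> if there is none). The terms of the series that defines it are those with \<open>u \<ge> 1\<close>.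
  It is not required below that \<open>series 1 f\<close> ignore the values \<open>f u\<close> with \<open>u \<le> 0\<close>;
  methods where it does are included.\<close>

definition glim :: "(int \<Rightarrow> (int \<Rightarrow> real) \<Rightarrow> real option) \<Rightarrow> (int \<Rightarrow> real) \<Rightarrow> real option" where
  "glim series F = series 1 (\<lambda>u. if u = 1 then F 1 else F u - F (u - 1))"

text \<open>The axioms. Equations between optional values mean that both sides are
  undefined, or both are defined and equal. Agreement with ordinary limits is not required: it
  contradicts the conventions \<open>analytic\<close> and \<open>symmetric_sums\<close>, as \<open>(exp x - exp (-x)) / (exp x + exp (-x))\<close>
  shows, a primitive (after a shift of the argument by 1/2) of a function whose sum over all
  integers would be both 0 and 2.\<close>

locale summation_method =
  fixes total :: "int set \<Rightarrow> (int \<Rightarrow> real) \<Rightarrow> real"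
    and series :: "int \<Rightarrow> (int \<Rightarrow> real) \<Rightarrow> real option"
  assumes finite_total: "finite G \<Longrightarrow> total G f = (\<Sum>u\<in>G. f u)"
    and postulate: "regular f \<Longrightarrow> \<exists>s. series 1 f = Some s"
    and A1: "regular f \<Longrightarrow> (\<And>n::int. S n = total (Zset a n) f) \<Longrightarrow> glim series S = series a f"
    and A2: "regular f \<Longrightarrow> (\<And>n::int. S n = total (Zset 1 (n div 2)) f) \<Longrightarrow> glim series S = series 1 f"
    and A3: "series a f1 = Some s1 \<Longrightarrow> series a f2 = Some s2 \<Longrightarrow>
        series a (\<lambda>u. \<alpha>1 * f1 u + \<alpha>2 * f2 u) = Some (\<alpha>1 * s1 + \<alpha>2 * s2)"
    and A4: "regular f \<Longrightarrow> a1 \<preceq>\<^sub>Z b1 \<Longrightarrow> a2 \<preceq>\<^sub>Z b2 \<Longrightarrow> closed_ivl a1 b1 \<inter> closed_ivl a2 b2 = {} \<Longrightarrow>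
        total (closed_ivl a1 b1 \<union> closed_ivl a2 b2) f = total (Zset a1 b1) f + total (Zset a2 b2) f"
    and analytic: "primitive_of F f \<Longrightarrow> a \<preceq>\<^sub>Z b \<Longrightarrow>
        total (Zset a b) f = the (F (of_int (b + 1))) - the (F (of_int a))"
    and symmetric_sums: "regular f \<Longrightarrow> glim series (\<lambda>n. total (Zset (- n) n) f) = Some (total UNIV f)"

end

theory Submission imports Defs begin

text \<open>Put \<open>g n = \<theta> (n + \<delta>)\<close>. Whatever \<open>\<epsilon>\<close> is, the hypothesis says \<open>g (- n - 1) = - g n\<close>.
  Apply the convention on symmetric sums to \<open>h n = g n - g (n - 1)\<close>, whose primitive is
  \<open>g (n - 1)\<close>: the sum from \<open>-n\<close> to \<open>n\<close> is \<open>g n - g (- n - 1) = 2 g n\<close>, and the sum over all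
  integers, which form the interval \<open>[0, -1]\<close>, telescopes to \<open>g (-1) - g (-1) = 0\<close>.
  No invariance of the generalized limit under shifts is needed.\<close>

text \<open>The map \<open>- 1 / u\<close> increases on each side of 0, is positive for
  \<open>u < 0\<close>, negative for \<open>u > 0\<close> and minus infinity at 0. So all negative
  integers come last.\<close>

lemma prec_iff: "a \<prec>\<^sub>Z b \<longleftrightarrow> (if 0 \<le> a then a < b \<or> b < 0 else a < b \<and> b < 0)"
proof -
  have val: "- 1 / ereal (of_int u) = (if u = 0 then - \<infinity> else ereal (- 1 / of_int u))" for u
    by (auto simp: divide_ereal_def one_ereal_def zero_ereal_def inverse_eq_divide)
  consider "a = 0" | "b = 0" | "a > 0" "b > 0" | "a > 0" "b < 0" | "a < 0" "b > 0" | "a < 0" "b < 0"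
    by linarith
  then show ?thesis
    unfolding prec_def val
    by cases (auto simp: field_simps)
qed

lemma preceq_iff: "a \<preceq>\<^sub>Z b \<longleftrightarrow> (if 0 \<le> a then a \<le> b \<or> b < 0 else a \<le> b \<and> b < 0)"
  by (auto simp: preceq_def prec_iff)

lemma Zset_zero_minus_one: "Zset 0 (- 1) = UNIV"
  by (auto simp: Zset_def closed_ivl_def preceq_iff)

text \<open>Brings a wrapped range into the form of two disjoint intervals to which
  \<open>A4\<close> applies.\<close>

lemma Zset_wrap:
  assumes "\<not> a \<preceq>\<^sub>Z b"
  shows "Zset a b = closed_ivl a (- 1) \<union> closed_ivl 0 b"
    and "closed_ivl a (- 1) \<inter> closed_ivl 0 b = {}"
  using assms
  by (auto simp: Zset_def closed_ivl_def open_ivl_def preceq_iff prec_iff split: if_splits)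

lemma algebraic_fun_affine: "algebraic_fun (\<lambda>x. Some (x + c))"
proof -
  \<comment> \<open>The nested list is the polynomial \<open>y - x - c\<close>, with outer variable
    \<open>y\<close>.\<close>
  have "poly (poly [:[:- c, - 1:], 1:] [:y:]) x = 0" if "Some (x + c) = Some y" for x y :: real
    using that by auto
  moreover have "[:[:- c, - 1:], 1:] \<noteq> (0 :: real poly poly)"
    by simp
  moreover have dom: "dom (\<lambda>x. Some (x + c)) = UNIV"
    by auto
  ultimately show ?thesis
    unfolding algebraic_fun_def dom
    by (intro conjI exI[of _ "[:[:- c, - 1:], 1:]"]) (auto intro!: continuous_intros)
qed

lemma elementary_shift:
  assumes "elementary F"
  shows "elementary (\<lambda>x. F (x + c))"
proof -
  have "(\<lambda>x. F (x + c)) = F \<circ>\<^sub>m (\<lambda>x. Some (x + c))"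
    by (simp add: map_comp_def fun_eq_iff)
  then show ?thesis
    using elementary.composition[OF assms elementary.algebraic[OF algebraic_fun_affine]] by simp
qed

context summation_method
begin

text \<open>In the wrapped case the sum splits at \<open>- 1\<close>, and the upper end value of the
  first piece, \<open>F 0\<close>, cancels the lower end value of the second.\<close>

lemma total_Zset:
  assumes F: "primitive_of F f"
  shows "total (Zset a b) f = the (F (of_int (b + 1))) - the (F (of_int a))"
proof (cases "a \<preceq>\<^sub>Z b")
  case True
  then show ?thesis using analytic[OF F] by simp
next
  case False
  have ivl: "a \<preceq>\<^sub>Z - 1" "0 \<preceq>\<^sub>Z b"
    by (auto simp: preceq_iff)
  have "regular f"
    using F by (auto simp: regular_def)
  then have "total (Zset a b) f = total (Zset a (- 1)) f + total (Zset 0 b) f"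
    using A4[OF _ ivl] Zset_wrap[OF False] by simp
  then show ?thesis
    using analytic[OF F ivl(1)] analytic[OF F ivl(2)] by simp
qed

lemma total_UNIV:
  assumes "primitive_of F f"
  shows "total UNIV f = 0"
  using total_Zset[OF assms, of 0 "- 1"] by (simp add: Zset_zero_minus_one)

lemma glim_scale:
  assumes "glim series F = Some s"
  shows "glim series (\<lambda>n. c * F n) = Some (c * s)"
proof -
  \<comment> \<open>The summand with factor 0 only gives the two-term shape of
    \<open>A3\<close>.\<close>
  have "(\<lambda>u. if u = 1 then c * F 1 else c * F u - c * F (u - 1)) =
      (\<lambda>u. c * (if u = 1 then F 1 else F u - F (u - 1)) + 0 * (if u = 1 then F 1 else F u - F (u - 1)))"
    by (auto simp: fun_eq_iff algebra_simps)
  then show ?thesis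
    using A3[OF assms[unfolded glim_def] assms[unfolded glim_def], of c 0] by (simp add: glim_def)
qed

lemma glim_odd:
  fixes g :: "int \<Rightarrow> real"
  assumes F: "elementary F" "\<And>n::int. F (of_int n) = Some (g n)"
    and odd: "\<And>n. g (- n - 1) = - g n"
  shows "glim series g = Some 0"
proof -
  have F': "primitive_of (\<lambda>x. F (x + (- 1))) (\<lambda>n. g n - g (n - 1))"
    unfolding primitive_of_def
  proof (intro conjI allI)
    show "of_int n \<in> dom (\<lambda>x. F (x + - 1))" for n
      using F(2)[of "n - 1"] by (simp add: domIff)
    show "the (F (of_int (n + 1) + - 1)) - the (F (of_int n + - 1)) = g n - g (n - 1)" for n
      using F(2)[of n] F(2)[of "n - 1"] by simp
  qed (rule elementary_shift[OF F(1)])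
  \<comment> \<open>For \<open>n > 0\<close> the range wraps, since \<open>- n\<close> then comes
    after \<open>n\<close> in the order.\<close>
  have "total (Zset (- n) n) (\<lambda>n. g n - g (n - 1)) = 2 * g n" for n
    using total_Zset[OF F', of "- n" n] F(2)[of n] F(2)[of "- n - 1"] odd[of n] by simp
  then have "glim series (\<lambda>n. 2 * g n) = Some 0"
    using symmetric_sums[of "\<lambda>n. g n - g (n - 1)"] F' total_UNIV[OF F']
    by (auto simp: regular_def)
  from glim_scale[OF this, of "1 / 2"] show ?thesis
    by simp
qed

end

theorem theorem4p17:
  fixes total :: "int set \<Rightarrow> (int \<Rightarrow> real) \<Rightarrow> real"
    and series :: "int \<Rightarrow> (int \<Rightarrow> real) \<Rightarrow> real option"
    and \<epsilon> \<delta> :: real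
    and \<theta> :: "real \<rightharpoonup> real"
  assumes "summation_method total series"
    and "\<epsilon> \<in> {0, 1, - 1}"
    and "\<delta> = (1 - \<epsilon>) / 2"
    and "elementary \<theta>"
    and "\<forall>n::int. of_int n + \<delta> \<in> dom \<theta>"
    and "\<forall>x. - x \<in> dom \<theta> \<longrightarrow> x - \<epsilon> \<in> dom \<theta> \<longrightarrow> the (\<theta> (- x)) = - the (\<theta> (x - \<epsilon>))"
  shows "glim series (\<lambda>n. the (\<theta> (of_int n + \<delta>))) = Some 0"
proof -
  interpret summation_method total series by fact
  show ?thesis
  proof (rule glim_odd[OF elementary_shift[OF assms(4)]])
    show "\<theta> (of_int n + \<delta>) = Some (the (\<theta> (of_int n + \<delta>)))" for n :: int
      using assms(5) by (auto simp: dom_def)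
    show "the (\<theta> (of_int (- n - 1) + \<delta>)) = - the (\<theta> (of_int n + \<delta>))" for n :: int
    proof -
      \<comment> \<open>Chosen so that \<open>x - \<epsilon>\<close> is \<open>n + \<delta>\<close>;
        then \<open>2 * \<delta> + \<epsilon> = 1\<close> turns \<open>- x\<close> into
        \<open>- n - 1 + \<delta>\<close>.\<close>
      define x where "x = of_int n + \<delta> + \<epsilon>"
      have x: "- x = of_int (- n - 1) + \<delta>" "x - \<epsilon> = of_int n + \<delta>"
        using assms(3) by (auto simp: x_def field_simps)
      show ?thesis
        using assms(6)[rule_format, of x] assms(5) unfolding x by blast
    qed
  qed
qed

end
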